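(* For any graph $G$ of minimum degree $\delta\ge 1$ and any noncomplete graph $H$, $$\gamma_r(G\circ H)\ge \max\{\gamma_r(G),\gamma_t(G),2\rho(G)\}.$$
   Context: Graphs are finite, simple and undirected. For a graph $G$, a function $f:V(G)\to\{0,1,2\}$ has weight $w(f)=\sum_{v\in V(G)}f(v)$; a vertex $v$ is undefended with respect to $f$ if $f(v)=0$ and $f(u)=0$ for every $u$ adjacent to $v$. The function $f$ is a weak Roman dominating function (WRDF) on $G$ if for every $v$ with $f(v)=0$ there is a vertex $u$ adjacent to $v$ with $f(u)\in\{1,2\}$ such that the function $f'$ defined by $f'(v)=1$, $f'(u)=f(u)-1$ and $f'(z)=f(z)$ for $z\notin\{u,v\}$ has no undefended vertices. The weak Roman domination number $\gamma_r(G)$ is the minimum weight of a WRDF on $G$. The lexicographic product $G\circ H$ has vertex set $V(G)\times V(H)$, and $(u,v)$ and $(x,y)$ are adjacent iff $ux\in E(G)$, or $u=x$ and $vy\in E(H)$. For a graph $G$ with no isolated vertex, $\gamma_t(G)$ is the minimum cardinality of a set $S\subseteq V(G)$ such that every vertex of $G$ is adjacent to at least one vertex of $S$. A $2$-packing of $G$ is a set $X\subseteq V(G)$ with $N[u]\cap N[v]=\emptyset$ for every pair of different vertices $u,v\in X$, where $N[u]$ is the closed neighbourhood of $u$; $\rho(G)$ is the maximum cardinality of a $2$-packing. *)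

theory Defs
  imports "Graph_Theory.Graph_Theory"
begin

(* A finite simple undirected graph is a pair_graph: a finite, symmetric, loopless set of arcs.
   An undirected edge uv appears as the two arcs (u, v) and (v, u). *)

definition open_nbhd :: "'a pair_pre_digraph \<Rightarrow> 'a \<Rightarrow> 'a set" where
  "open_nbhd G v = {u \<in> pverts G. (v, u) \<in> parcs G}"

definition closed_nbhd :: "'a pair_pre_digraph \<Rightarrow> 'a \<Rightarrow> 'a set" where
  "closed_nbhd G v = insert v (open_nbhd G v)"

(* In a symmetric graph without parallel arcs the out-degree of a vertex is its degree.
   The value is meaningful only if there is at least one vertex. *)
definition min_degree :: "'a pair_pre_digraph \<Rightarrow> nat" where
  "min_degree G = Min (out_degree (with_proj G) ` pverts G)"

definition complete_graph :: "'a pair_pre_digraph \<Rightarrow> bool" where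
  "complete_graph G \<longleftrightarrow> complete_digraph (card (pverts G)) (with_proj G)"

definition lexicographic_product ::
    "'a pair_pre_digraph \<Rightarrow> 'b pair_pre_digraph \<Rightarrow> ('a \<times> 'b) pair_pre_digraph" where
  "lexicographic_product G H =
    \<lparr> pverts = pverts G \<times> pverts H,
      parcs = {((u, v), (x, y)) | u v x y.
        (u, v) \<in> pverts G \<times> pverts H \<and> (x, y) \<in> pverts G \<times> pverts H \<and>
        ((u, x) \<in> parcs G \<or> u = x \<and> (v, y) \<in> parcs H)} \<rparr>"

definition weight :: "'a pair_pre_digraph \<Rightarrow> ('a \<Rightarrow> nat) \<Rightarrow> nat" where
  "weight G f = (\<Sum>v\<in>pverts G. f v)"

definition undefended :: "'a pair_pre_digraph \<Rightarrow> ('a \<Rightarrow> nat) \<Rightarrow> 'a \<Rightarrow> bool" where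
  "undefended G f v \<longleftrightarrow> v \<in> pverts G \<and> f v = 0 \<and> (\<forall>u\<in>open_nbhd G v. f u = 0)"

(* The values of f outside the vertex set are irrelevant. *)
definition wrdf :: "'a pair_pre_digraph \<Rightarrow> ('a \<Rightarrow> nat) \<Rightarrow> bool" where
  "wrdf G f \<longleftrightarrow>
    f \<in> pverts G \<rightarrow> {0, 1, 2} \<and>
    (\<forall>v\<in>pverts G. f v = 0 \<longrightarrow>
      (\<exists>u\<in>open_nbhd G v. f u \<in> {1, 2} \<and>
        (\<nexists>z. undefended G (f(v := 1, u := f u - 1)) z)))"

definition weak_roman_domination_number :: "'a pair_pre_digraph \<Rightarrow> nat" where
  "weak_roman_domination_number G = (LEAST k. \<exists>f. wrdf G f \<and> weight G f = k)"

definition total_dominating :: "'a pair_pre_digraph \<Rightarrow> 'a set \<Rightarrow> bool" where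
  "total_dominating G S \<longleftrightarrow>
    S \<subseteq> pverts G \<and> (\<forall>v\<in>pverts G. \<exists>u\<in>S. u \<in> open_nbhd G v)"

(* Meaningful only if no vertex is isolated: otherwise there is no total dominating set. *)
definition total_domination_number :: "'a pair_pre_digraph \<Rightarrow> nat" where
  "total_domination_number G = (LEAST k. \<exists>S. total_dominating G S \<and> card S = k)"

definition two_packing :: "'a pair_pre_digraph \<Rightarrow> 'a set \<Rightarrow> bool" where
  "two_packing G X \<longleftrightarrow>
    X \<subseteq> pverts G \<and>
    (\<forall>u\<in>X. \<forall>v\<in>X. u \<noteq> v \<longrightarrow> closed_nbhd G u \<inter> closed_nbhd G v = {})"

definition packing_number :: "'a pair_pre_digraph \<Rightarrow> nat" where
  "packing_number G = Max (card ` {X. two_packing G X})"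

lemma pair_graph_lexicographic_product:
  assumes "pair_graph G" "pair_graph H"
  shows "pair_graph (lexicographic_product G H)"
proof -
  interpret G: pair_graph G by fact
  interpret H: pair_graph H by fact
  have "finite ((pverts G \<times> pverts H) \<times> (pverts G \<times> pverts H))"
    using G.pair_finite_verts H.pair_finite_verts by simp
  moreover have "parcs (lexicographic_product G H) \<subseteq> (pverts G \<times> pverts H) \<times> (pverts G \<times> pverts H)"
    by (auto simp: lexicographic_product_def)
  ultimately have "finite (parcs (lexicographic_product G H))"
    by (rule rev_finite_subset)
  then show ?thesis
    using G.pair_finite_verts H.pair_finite_verts
    by unfold_locales
      (auto simp: lexicographic_product_def symmetric_def intro!: symI
        dest: G.arcs_symmetric H.arcs_symmetric G.no_loops' H.no_loops')
qed

lemma complete_graph_iff: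
  assumes "pair_graph G"
  shows "complete_graph G \<longleftrightarrow>
    (\<forall>u\<in>pverts G. \<forall>v\<in>pverts G. u \<noteq> v \<longrightarrow> (u, v) \<in> parcs G)"
proof -
  interpret pair_graph G by fact
  show ?thesis
    unfolding complete_graph_def complete_digraph_pair_def
    by (auto dest: no_loops' in_arcsD1 in_arcsD2 simp: pair_finite_verts)
qed

lemma out_degree_eq_card_open_nbhd:
  assumes "pair_graph G"
  shows "out_degree (with_proj G) v = card (open_nbhd G v)"
proof -
  interpret pair_graph G by fact
  have "out_arcs (with_proj G) v = Pair v ` open_nbhd G v"
    by (auto simp: out_arcs_def open_nbhd_def dest: in_arcsD2)
  then show ?thesis
    by (simp add: out_degree_def card_image inj_on_def)
qed

lemma weak_roman_domination_number_attained:
  obtains f where "wrdf G f" "weight G f = weak_roman_domination_number G"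
proof -
  have "wrdf G (\<lambda>_. 1)" by (auto simp: wrdf_def)
  then have "\<exists>k f. wrdf G f \<and> weight G f = k" by blast
  from LeastI_ex[OF this] show ?thesis
    using that unfolding weak_roman_domination_number_def by blast
qed

lemma total_domination_number_attained:
  assumes "pair_graph G" "pverts G \<noteq> {}" "min_degree G \<ge> 1"
  obtains S where "total_dominating G S" "card S = total_domination_number G"
proof -
  interpret pair_graph G by fact
  have "open_nbhd G v \<noteq> {}" if "v \<in> pverts G" for v
  proof -
    have "min_degree G \<le> out_degree (with_proj G) v"
      unfolding min_degree_def using that by (intro Min_le) (auto simp: pair_finite_verts)
    then show ?thesis
      using assms(3) by (auto simp: out_degree_eq_card_open_nbhd[OF assms(1)])
  qed
  then have "total_dominating G (pverts G)"
    by (fastforce simp: total_dominating_def open_nbhd_def)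
  then have "\<exists>k S. total_dominating G S \<and> card S = k" by blast
  from LeastI_ex[OF this] show ?thesis
    using that unfolding total_domination_number_def by blast
qed

lemma packing_number_attained:
  assumes "pair_graph G"
  obtains X where "two_packing G X" "card X = packing_number G"
proof -
  interpret pair_graph G by fact
  have "{X. two_packing G X} \<subseteq> Pow (pverts G)" by (auto simp: two_packing_def)
  then have "finite (card ` {X. two_packing G X})"
    using pair_finite_verts by (meson finite_Pow_iff finite_imageI finite_subset)
  moreover have "two_packing G {}" by (simp add: two_packing_def)
  ultimately have "packing_number G \<in> card ` {X. two_packing G X}"
    unfolding packing_number_def by (intro Max_in) auto
  then show ?thesis using that by auto
qed

end

theory Submission
  imports Defs
begin

text \<open>
  Let \<open>f\<close> be a weak Roman dominating function on \<open>G \<circ> H\<close> and let \<open>s u\<close> be its total weight on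
  the copy of \<open>H\<close> over the vertex \<open>u\<close>. As \<open>H\<close> has two nonadjacent vertices,
  \<open>s\<close> has weight at least 2 on every closed neighbourhood of \<open>G\<close>; summing over a 2-packing gives
  the bound \<open>2 \<rho>(G)\<close>. Moreover every vertex \<open>u\<close> with \<open>s u \<le> 1\<close> then has a neighbour in the support
  of \<open>s\<close>, so adding one neighbour of each vertex with \<open>s u \<ge> 2\<close> to the support gives a total
  dominating set of size at most the weight of \<open>f\<close>. Finally, \<open>min 2 (s u)\<close> is a weak Roman
  dominating function on \<open>G\<close>, because a move in \<open>G \<circ> H\<close> between two copies of \<open>H\<close> changes the
  supports of \<open>s\<close> and of \<open>min 2 (s u)\<close> in the same way.
\<close>

definition fibre_weight :: "'b pair_pre_digraph \<Rightarrow> ('a \<times> 'b \<Rightarrow> nat) \<Rightarrow> 'a \<Rightarrow> nat" where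
  "fibre_weight H f u = (\<Sum>h\<in>pverts H. f (u, h))"

lemma pverts_lexicographic_product [simp]:
  "pverts (lexicographic_product G H) = pverts G \<times> pverts H"
  by (simp add: lexicographic_product_def)

lemma open_nbhd_lexicographic_product_iff:
  "(x, y) \<in> open_nbhd (lexicographic_product G H) (u, v) \<longleftrightarrow>
    u \<in> pverts G \<and> v \<in> pverts H \<and> x \<in> pverts G \<and> y \<in> pverts H \<and>
    (x \<in> open_nbhd G u \<or> u = x \<and> y \<in> open_nbhd H v)"
  by (auto simp: open_nbhd_def lexicographic_product_def)

lemma weight_lexicographic_product:
  "weight (lexicographic_product G H) f = sum (fibre_weight H f) (pverts G)"
  by (simp add: weight_def fibre_weight_def sum.cartesian_product)

lemma sum_fibre_weight: "sum (fibre_weight H f) A = sum f (A \<times> pverts H)"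
  by (simp add: fibre_weight_def sum.cartesian_product)

lemma fibre_weight_eq_0_iff:
  assumes "finite (pverts H)"
  shows "fibre_weight H f u = 0 \<longleftrightarrow> (\<forall>h\<in>pverts H. f (u, h) = 0)"
  using assms by (simp add: fibre_weight_def)

lemma closed_nbhd_subset:
  "v \<in> pverts G \<Longrightarrow> closed_nbhd G v \<subseteq> pverts G"
  by (auto simp: closed_nbhd_def open_nbhd_def)

lemma open_nbhd_nonempty:
  assumes "pair_graph G" "min_degree G \<ge> 1" "v \<in> pverts G"
  shows "open_nbhd G v \<noteq> {}"
proof -
  interpret pair_graph G by fact
  have "min_degree G \<le> card (open_nbhd G v)"
    unfolding min_degree_def using assms(3) pair_finite_verts
    by (intro Min_le) (auto simp flip: out_degree_eq_card_open_nbhd[OF assms(1)])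
  with assms(2) show ?thesis by auto
qed

text \<open>The closed neighbourhoods around a 2-packing are pairwise disjoint, so their separate
  contributions of at least \<open>k\<close> add up.\<close>

lemma packing_number_bound:
  assumes "pair_graph G"
    and *: "\<And>u. u \<in> pverts G \<Longrightarrow> k \<le> sum s (closed_nbhd G u)"
  shows "k * packing_number G \<le> sum s (pverts G)"
proof -
  interpret pair_graph G by fact
  obtain X where X: "two_packing G X" "card X = packing_number G"
    using packing_number_attained[OF assms(1)] .
  have sub: "X \<subseteq> pverts G" using X by (simp add: two_packing_def)
  have fin: "finite X" using sub pair_finite_verts finite_subset by blast
  have "k * packing_number G = (\<Sum>u\<in>X. k)" using X by simp
  also have "\<dots> \<le> (\<Sum>u\<in>X. sum s (closed_nbhd G u))"
    using * sub by (intro sum_mono) auto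
  also have "\<dots> = sum s (\<Union>u\<in>X. closed_nbhd G u)"
  proof (rule sum.UNION_disjoint[symmetric])
    show "\<forall>u\<in>X. finite (closed_nbhd G u)"
      using sub by (auto intro: finite_subset[OF closed_nbhd_subset pair_finite_verts])
  qed (use X(1) fin in \<open>auto simp: two_packing_def\<close>)
  also have "\<dots> \<le> sum s (pverts G)"
    using sub closed_nbhd_subset[of _ G] pair_finite_verts by (intro sum_mono2) auto
  finally show ?thesis .
qed

lemma total_domination_number_bound:
  assumes "pair_graph G" "min_degree G \<ge> 1"
    and *: "\<And>u. u \<in> pverts G \<Longrightarrow> 2 \<le> sum s (closed_nbhd G u)"
  shows "total_domination_number G \<le> sum s (pverts G)"
proof -
  interpret pair_graph G by fact
  define A where "A = {u \<in> pverts G. 1 \<le> s u}"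
  define B where "B = {u \<in> pverts G. 2 \<le> s u}"
  define n where "n u = (SOME x. x \<in> open_nbhd G u)" for u
  have n: "n u \<in> open_nbhd G u" if "u \<in> pverts G" for u
    unfolding n_def using open_nbhd_nonempty[OF assms(1,2) that] by (simp add: some_in_eq)
  have fin: "finite A" "finite B"
    using pair_finite_verts by (auto simp: A_def B_def)
  have "\<exists>x\<in>A \<union> n ` B. x \<in> open_nbhd G u" if u: "u \<in> pverts G" for u
  proof (cases "2 \<le> s u")
    case True
    with n[OF u] u show ?thesis by (auto simp: B_def)
  next
    case False
    \<comment> \<open>A vertex with \<open>s u \<le> 1\<close> cannot supply the required 2 alone,
      so some neighbour lies in the support \<open>A\<close>.\<close>
    have "sum s (closed_nbhd G u) \<le> s u + sum s (open_nbhd G u)"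
      using pair_finite_verts
      by (auto simp: closed_nbhd_def sum.insert_if open_nbhd_def)
    with *[OF u] False have "sum s (open_nbhd G u) \<noteq> 0" by linarith
    then obtain x where "x \<in> open_nbhd G u" "s x \<noteq> 0"
      by (meson sum.neutral)
    then show ?thesis by (auto simp: A_def open_nbhd_def)
  qed
  moreover have "A \<union> n ` B \<subseteq> pverts G"
    using n by (auto simp: A_def B_def open_nbhd_def)
  ultimately have "total_dominating G (A \<union> n ` B)"
    by (auto simp: total_dominating_def)
  then have "total_domination_number G \<le> card (A \<union> n ` B)"
    unfolding total_domination_number_def by (intro Least_le) blast
  also have "\<dots> \<le> card A + card B"
    using card_Un_le[of A "n ` B"] card_image_le[OF fin(2), of n] by linarith
  \<comment> \<open>The two indicators at \<open>u\<close> add up to \<open>min 2 (s u)\<close>: a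
    vertex of \<open>B\<close> pays for itself and for its chosen neighbour.\<close>
  also have "\<dots> = (\<Sum>u\<in>pverts G. of_bool (1 \<le> s u) + of_bool (2 \<le> s u))"
    using pair_finite_verts by (simp add: A_def B_def sum.distrib sum_of_bool_eq Int_def)
  also have "\<dots> \<le> sum s (pverts G)"
    by (intro sum_mono) auto
  finally show ?thesis .
qed

text \<open>With weight at most 1 around \<open>u\<close>, a single unit has to defend both of two
  nonadjacent vertices \<open>(u, a)\<close> and \<open>(u, b)\<close>. Moving it to one of them
  leaves the other undefended.\<close>

lemma two_le_sum_closed_nbhd:
  assumes "pair_graph G" "pair_graph H" "\<not> complete_graph H"
    and f: "wrdf (lexicographic_product G H) f" and u: "u \<in> pverts G"
  shows "2 \<le> sum (fibre_weight H f) (closed_nbhd G u)"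
proof (rule ccontr)
  assume less: "\<not> ?thesis"
  interpret G: pair_graph G by fact
  interpret H: pair_graph H by fact
  let ?L = "lexicographic_product G H"
  define C where "C = closed_nbhd G u \<times> pverts H"
  obtain a b where ab: "a \<in> pverts H" "b \<in> pverts H" "a \<noteq> b" "(a, b) \<notin> parcs H"
    using assms(2,3) by (auto simp: complete_graph_iff)
  have ba: "(b, a) \<notin> parcs H" using ab(4) H.arcs_symmetric by blast
  have C: "finite C"
    unfolding C_def using closed_nbhd_subset[OF u] G.pair_finite_verts H.pair_finite_verts
    by (blast intro: finite_subset)
  have le1: "sum f C \<le> 1" using less by (simp add: C_def sum_fibre_weight)
  have unique: "f p \<le> 1" "q = p" if "p \<in> C" "f p \<noteq> 0" "q \<in> C" "f q \<noteq> 0" for p q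
  proof -
    have "sum f {p} \<le> sum f C" using C that by (intro sum_mono2) auto
    then show "f p \<le> 1" using le1 by simp
    show "q = p"
    proof (rule ccontr)
      assume "q \<noteq> p"
      then have "f p + f q = sum f {p, q}" by simp
      also have "\<dots> \<le> sum f C" using C that by (intro sum_mono2) auto
      finally show False using le1 that by simp
    qed
  qed
  \<comment> \<open>Only values on \<open>C\<close> can affect the defence of the copy of
    \<open>H\<close> over \<open>u\<close>.\<close>
  have nbhd: "open_nbhd ?L (u, h) \<subseteq> C" for h
    using u by (auto simp: C_def open_nbhd_lexicographic_product_iff closed_nbhd_def)
  have inC: "(u, h) \<in> C" if "h \<in> pverts H" for h
    using that by (simp add: C_def closed_nbhd_def)
  \<comment> \<open>As \<open>G\<close> has no loops, vertices of one copy are adjacent only through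
    \<open>H\<close>.\<close>
  have nonadj: "(u, b) \<notin> open_nbhd ?L (u, a)" "(u, a) \<notin> open_nbhd ?L (u, b)"
    using ab(4) ba G.no_loops'[of u u]
    unfolding open_nbhd_lexicographic_product_iff by (auto simp: open_nbhd_def)
  have defender: "\<exists>p\<in>open_nbhd ?L (u, h). f p \<in> {1, 2} \<and>
      (\<nexists>z. undefended ?L (f((u, h) := 1, p := f p - 1)) z)"
    if "h \<in> pverts H" "f (u, h) = 0" for h
    using f u that by (auto simp: wrdf_def)
  \<comment> \<open>A unit on \<open>(u, h)\<close> would be the only one in \<open>C\<close>, so
    the nonadjacent vertex \<open>(u, k)\<close> would have no defender.\<close>
  have zero: "f (u, h) = 0"
    if h: "h \<in> pverts H" and k: "k \<in> pverts H" "h \<noteq> k" "(u, h) \<notin> open_nbhd ?L (u, k)" for h k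
  proof (rule ccontr)
    assume nz: "f (u, h) \<noteq> 0"
    then have "f (u, k) = 0" using unique(2) inC h k by blast
    from defender[OF k(1) this] obtain p where "p \<in> open_nbhd ?L (u, k)" "f p \<noteq> 0"
      by auto
    with unique(2)[OF inC[OF h] nz] nbhd k(3) show False by blast
  qed
  have "f (u, a) = 0" and b0: "f (u, b) = 0"
    using zero[of a b] zero[of b a] ab nonadj by auto
  from defender[OF ab(1) this(1)] obtain p where
    p: "p \<in> open_nbhd ?L (u, a)" "f p \<noteq> 0"
      "\<nexists>z. undefended ?L (f((u, a) := 1, p := f p - 1)) z"
    by auto
  let ?f' = "f((u, a) := 1, p := f p - 1)"
  have pC: "p \<in> C" using p(1) nbhd by blast
  \<comment> \<open>The defender \<open>p\<close> held exactly 1 and was the only positive vertex of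
    \<open>C\<close>, so after the move only \<open>(u, a)\<close> can be positive there.\<close>
  have f'0: "?f' q = 0" if "q \<in> C" "q \<noteq> (u, a)" for q
    using unique[OF pC p(2) that(1)] unique(1)[OF pC p(2) pC p(2)] that by auto
  have "undefended ?L ?f' (u, b)"
    unfolding undefended_def
  proof (intro conjI ballI)
    show "?f' (u, b) = 0" using f'0 inC ab by auto
    show "?f' q = 0" if "q \<in> open_nbhd ?L (u, b)" for q
    proof (rule f'0)
      show "q \<in> C" using that nbhd by blast
      show "q \<noteq> (u, a)" using that nonadj(2) by blast
    qed
  qed (use u ab in simp)
  with p(3) show False by blast
qed

text \<open>A defending move in the product projects to a move in \<open>G\<close>. Truncation at 2
  is harmless, since a copy of weight at least 2 stays positive after losing one unit.\<close>

lemma wrdf_min_fibre_weight: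
  assumes "pair_graph G" "pair_graph H" "pverts H \<noteq> {}"
    and f: "wrdf (lexicographic_product G H) f"
  shows "wrdf G (\<lambda>u. min 2 (fibre_weight H f u))"
  unfolding wrdf_def
proof (intro conjI ballI impI)
  interpret G: pair_graph G by fact
  interpret H: pair_graph H by fact
  let ?L = "lexicographic_product G H" and ?s = "fibre_weight H f"
  let ?g = "\<lambda>u. min 2 (?s u)"
  show "?g \<in> pverts G \<rightarrow> {0, 1, 2}" by auto
  fix u assume u: "u \<in> pverts G" and "?g u = 0"
  then have u0: "f (u, h) = 0" if "h \<in> pverts H" for h
    using that fibre_weight_eq_0_iff[OF H.pair_finite_verts, of f u] by (auto simp: min_def split: if_splits)
  obtain h where h: "h \<in> pverts H" using assms(3) by blast
  then obtain x y where xy: "(x, y) \<in> open_nbhd ?L (u, h)" "f (x, y) \<in> {1, 2}"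
      "\<nexists>z. undefended ?L (f((u, h) := 1, (x, y) := f (x, y) - 1)) z"
    using f u u0[OF h] by (fastforce simp: wrdf_def)
  have y: "y \<in> pverts H" using xy(1) by (simp add: open_nbhd_lexicographic_product_iff)
  \<comment> \<open>The copy over \<open>u\<close> has weight 0, so the defender sits over a
    neighbour of \<open>u\<close>.\<close>
  have "x \<noteq> u" using xy(2) y u0 by auto
  then have x: "x \<in> open_nbhd G u"
    using xy(1) by (auto simp: open_nbhd_lexicographic_product_iff)
  have split: "?s x = f (x, y) + (\<Sum>k\<in>pverts H - {y}. f (x, k))"
    unfolding fibre_weight_def using y H.pair_finite_verts by (simp add: sum.remove)
  let ?f' = "f((u, h) := 1, (x, y) := f (x, y) - 1)" and ?g' = "?g(u := 1, x := ?g x - 1)"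
  \<comment> \<open>At \<open>z = x\<close>, a zero of \<open>?g'\<close> forces
    \<open>?s x = 1\<close>, so the moved unit was all the weight of that copy. The case
    \<open>z = u\<close> is void, as \<open>?g' u = 1\<close>.\<close>
  have supp: "?f' (z, k) = 0" if z: "?g' z = 0" and k: "k \<in> pverts H" for z k
  proof (cases "z = x")
    case True
    with z have "?s x \<le> 1" by auto
    with split xy(2) have "f (x, y) = 1" "(\<Sum>k\<in>pverts H - {y}. f (x, k)) = 0" by auto
    then show ?thesis
      using True k H.pair_finite_verts \<open>x \<noteq> u\<close> by auto
  next
    case False
    with z have "z \<noteq> u" "?s z = 0" by (auto simp: min_def split: if_splits)
    then show ?thesis
      using False k by (simp add: fibre_weight_eq_0_iff[OF H.pair_finite_verts])
  qed
  have "\<not> undefended G ?g' z" for z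
  proof
    assume z: "undefended G ?g' z"
    then have g'0: "?g' a = 0" if "a \<in> open_nbhd G z \<or> a = z" for a
      using that unfolding undefended_def by blast
    \<comment> \<open>Any vertex over \<open>z\<close> would serve here: all its neighbours lie over
      the closed neighbourhood of \<open>z\<close>, where \<open>supp\<close> makes
      \<open>?f'\<close> vanish.\<close>
    have "undefended ?L ?f' (z, h)"
      unfolding undefended_def
    proof (intro conjI ballI)
      show "(z, h) \<in> pverts ?L" using z h by (simp add: undefended_def)
      show "?f' (z, h) = 0" by (rule supp[OF g'0 h]) simp
      fix q assume q: "q \<in> open_nbhd ?L (z, h)"
      obtain a b where ab: "q = (a, b)" by fastforce
      have a: "a \<in> open_nbhd G z \<or> a = z" and b: "b \<in> pverts H"
        using q ab by (auto simp: open_nbhd_lexicographic_product_iff)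
      show "?f' q = 0"
        unfolding ab by (rule supp[OF g'0[OF a] b])
    qed
    with xy(3) show False by blast
  qed
  moreover have "?g x \<in> {1, 2}"
  proof -
    have "1 \<le> ?s x" using split xy(2) by auto
    then show ?thesis by (simp add: min_def)
  qed
  ultimately show "\<exists>x\<in>open_nbhd G u. ?g x \<in> {1, 2} \<and>
      (\<nexists>z. undefended G (?g(u := 1, x := ?g x - 1)) z)"
    using x by blast
qed

theorem theorem22:
  fixes G :: "'a pair_pre_digraph" and H :: "'b pair_pre_digraph"
  assumes "pair_graph G" and "pverts G \<noteq> {}" and "min_degree G \<ge> 1"
    and "pair_graph H" and "\<not> complete_graph H"
  shows "weak_roman_domination_number (lexicographic_product G H)
    \<ge> Max {weak_roman_domination_number G, total_domination_number G, 2 * packing_number G}"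
proof -
  let ?L = "lexicographic_product G H"
  obtain f where f: "wrdf ?L f" "weight ?L f = weak_roman_domination_number ?L"
    using weak_roman_domination_number_attained .
  let ?s = "fibre_weight H f"
  have w: "weak_roman_domination_number ?L = sum ?s (pverts G)"
    using f(2) by (simp add: weight_lexicographic_product)
  have two: "2 \<le> sum ?s (closed_nbhd G u)" if "u \<in> pverts G" for u
    using two_le_sum_closed_nbhd[OF assms(1,4,5) f(1) that] .
  \<comment> \<open>The graph without vertices counts as complete.\<close>
  have "pverts H \<noteq> {}"
    using assms(4,5) by (auto simp: complete_graph_iff)
  then have "wrdf G (\<lambda>u. min 2 (?s u))"
    using wrdf_min_fibre_weight[OF assms(1,4)] f(1) by blast
  then have "weak_roman_domination_number G \<le> weight G (\<lambda>u. min 2 (?s u))"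
    unfolding weak_roman_domination_number_def by (intro Least_le) blast
  also have "\<dots> \<le> sum ?s (pverts G)"
    unfolding weight_def by (intro sum_mono) simp
  finally show ?thesis
    using total_domination_number_bound[OF assms(1,3) two]
      packing_number_bound[OF assms(1) two] w
    by simp
qed

end
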